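(* Let $(\mathfrak{g}_T,\mu)$ be a Rota-Baxter Leibniz algebra. If $H^2_{RBLA}(\mathfrak{g},\mathfrak{g})=0$, then $(\mathfrak{g}_T,\mu)$ is rigid.
   Context: All vector spaces are over a fixed field $\mathbb{K}$. A (left) Leibniz algebra is a vector space $\mathfrak{g}$ with a bilinear bracket $\mu=[\,,\,]_{\mathfrak{g}}$ satisfying $[x,[y,z]_{\mathfrak{g}}]_{\mathfrak{g}}=[[x,y]_{\mathfrak{g}},z]_{\mathfrak{g}}+[y,[x,z]_{\mathfrak{g}}]_{\mathfrak{g}}$. A Rota-Baxter operator is a linear map $T:\mathfrak{g}\to\mathfrak{g}$ with $[T(x),T(y)]_{\mathfrak{g}}=T([T(x),y]_{\mathfrak{g}}+[x,T(y)]_{\mathfrak{g}})$. A Rota-Baxter Leibniz algebra $(\mathfrak{g}_T,\mu)$ is a Leibniz algebra together with a Rota-Baxter operator $T$. Cohomology of $(\mathfrak{g}_T,\mu)$ with coefficients in itself. Put $C^n_{LA}(\mathfrak{g},\mathfrak{g})=C^n_{RBO}(\mathfrak{g},\mathfrak{g})=\mathrm{Hom}(\mathfrak{g}^{\otimes n},\mathfrak{g})$, $n\ge0$. For bilinear maps $l,r:\mathfrak{g}\times\mathfrak{g}\to\mathfrak{g}$ and a bracket $[\,,\,]$ on $\mathfrak{g}$ consider the formula $$\begin{aligned}&\sum_{i=1}^{n}(-1)^{i+1}l(x_i,f(x_1,\dots,\widehat{x_i},\dots,x_{n+1}))+(-1)^{n+1}r(f(x_1,\dots,x_n),x_{n+1})\\&+\sum_{1\le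 i<j\le n+1}(-1)^i f(x_1,\dots,\widehat{x_i},\dots,x_{j-1},[x_i,x_j],x_{j+1},\dots,x_{n+1}).\end{aligned}$$ $(\delta^nf)(x_1,\dots,x_{n+1})$ is this expression with $l(x,u)=[x,u]_{\mathfrak{g}}$, $r(u,x)=[u,x]_{\mathfrak{g}}$ and bracket $[\,,\,]_{\mathfrak{g}}$; $(\partial^nf)(x_1,\dots,x_{n+1})$ is this expression with $l(x,u)=[T(x),u]_{\mathfrak{g}}-T([x,u]_{\mathfrak{g}})$, $r(u,x)=[u,T(x)]_{\mathfrak{g}}-T([u,x]_{\mathfrak{g}})$ and bracket $[x,y]_*=[x,T(y)]_{\mathfrak{g}}+[T(x),y]_{\mathfrak{g}}$. Also $$\phi^n(f)(x_1,\dots,x_n)=f(Tx_1,\dots,Tx_n)-\sum_{i=1}^n T\big(f(Tx_1,\dots,Tx_{i-1},x_i,Tx_{i+1},\dots,Tx_n)\big).$$ For $n\ge1$, $C^n_{RBLA}(\mathfrak{g},\mathfrak{g})=C^n_{LA}(\mathfrak{g},\mathfrak{g})\oplus C^{n-1}_{RBO}(\mathfrak{g},\mathfrak{g})$ and $d^n(\alpha,\beta)=(\delta^n(\alpha),-\partial^{n-1}(\beta)-\phi^n(\alpha))$. $H^2_{RBLA}(\mathfrak{g},\mathfrak{g})=\ker d^2/\operatorname{im} d^1$. A formal one-parameter deformation of $(\mathfrak{g}_T,\mu)$ is a pair of power series $\mu_t=\sum_{i\ge0}\mu_it^i$, $T_t=\sum_{i\ge0}T_it^i$ with $\mu_i:\mathfrak{g}\otimes\mathfrak{g}\to\mathfrak{g}$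 and $T_i:\mathfrak{g}\to\mathfrak{g}$ linear, $(\mu_0,T_0)=(\mu,T)$, such that (extending $\mathbb{K}[[t]]$-linearly) $(\mathfrak{g}[[t]]_{T_t},\mu_t)$ is a Rota-Baxter Leibniz algebra. Two deformations $(\mu_t,T_t)$, $(\mu'_t,T'_t)$ are equivalent if there is a formal isomorphism $\psi_t=\sum_{i\ge0}\psi_it^i:\mathfrak{g}[[t]]\to\mathfrak{g}[[t]]$, with $\psi_i:\mathfrak{g}\to\mathfrak{g}$ linear and $\psi_0=\mathrm{id}_{\mathfrak{g}}$, such that $\psi_t\circ\mu'_t=\mu_t\circ(\psi_t\otimes\psi_t)$ and $\psi_t\circ T'_t=T_t\circ\psi_t$. A deformation is called trivial if it is equivalent to the deformation $(\mu_t,T_t)=(\mu,T)$ (all higher coefficients zero). $(\mathfrak{g}_T,\mu)$ is rigid if every formal one-parameter deformation of it is trivial. *)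

theory Defs
  imports
    Complex_Main
    "HOL-Computational_Algebra.Formal_Power_Series"
    "HOL-Library.Function_Algebras"
    "HOL-Library.Product_Plus"
    "HOL-Library.Set_Algebras"
begin

text \<open>The ground ring is a commutative ring rather than a field because deformations live
  over \<open>\<bbbK>[[t]]\<close>. Over a field, \<open>module\<close> is \<open>vector_space\<close> (\<open>module_iff_vector_space\<close>).\<close>

locale leibniz_algebra = module scale
  for scale :: "'k::comm_ring_1 \<Rightarrow> 'g::ab_group_add \<Rightarrow> 'g" +
  fixes bracket :: "'g \<Rightarrow> 'g \<Rightarrow> 'g"
  assumes linear_right: "module_hom scale scale (\<lambda>y. bracket x y)"
    and linear_left: "module_hom scale scale (\<lambda>x. bracket x y)"
    and leibniz: "bracket x (bracket y z) = bracket (bracket x y) z + bracket y (bracket x z)"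

locale rota_baxter_leibniz_algebra = leibniz_algebra scale bracket
  for scale :: "'k::comm_ring_1 \<Rightarrow> 'g::ab_group_add \<Rightarrow> 'g"
    and bracket :: "'g \<Rightarrow> 'g \<Rightarrow> 'g" +
  fixes T :: "'g \<Rightarrow> 'g"
  assumes linear_T: "module_hom scale scale T"
    and rota_baxter: "bracket (T x) (T y) = T (bracket (T x) y + bracket x (T y))"


section \<open>Cohomology\<close>

text \<open>An element of \<open>Hom(\<gg>\<^sup>\<otimes>\<^sup>n, \<gg>)\<close> is an \<open>n\<close>-linear map, encoded as a function on lists which is
  \<open>0\<close> on lists of length other than \<open>n\<close>, so that equality of cochains is equality of functions.
  List positions are counted from \<open>0\<close>: the argument \<open>x\<^sub>i\<close> of the usual formulas is
  \<open>xs ! (i - 1)\<close>, which changes the sign \<open>(-1)\<^sup>i\<close> into \<open>(-1)\<^sup>i\<^sup>+\<^sup>1\<close>.\<close>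

definition cochains :: "('k::field \<Rightarrow> 'g::ab_group_add \<Rightarrow> 'g) \<Rightarrow> nat \<Rightarrow> ('g list \<Rightarrow> 'g) set" where
  "cochains scale n = {f.
     (\<forall>xs. length xs \<noteq> n \<longrightarrow> f xs = 0) \<and>
     (\<forall>xs i. length xs = n \<longrightarrow> i < n \<longrightarrow> module_hom scale scale (\<lambda>u. f (xs[i := u])))}"

definition omit :: "nat \<Rightarrow> 'a list \<Rightarrow> 'a list" where
  "omit i xs = take i xs @ drop (Suc i) xs"

definition loday_coboundary ::
  "('k::field \<Rightarrow> 'g::ab_group_add \<Rightarrow> 'g) \<Rightarrow> ('g \<Rightarrow> 'g \<Rightarrow> 'g) \<Rightarrow> ('g \<Rightarrow> 'g \<Rightarrow> 'g) \<Rightarrow> ('g \<Rightarrow> 'g \<Rightarrow> 'g)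
    \<Rightarrow> nat \<Rightarrow> ('g list \<Rightarrow> 'g) \<Rightarrow> 'g list \<Rightarrow> 'g" where
  "loday_coboundary scale l r br n f xs =
     (if length xs = Suc n then
        (\<Sum>i<n. scale ((-1) ^ i) (l (xs ! i) (f (omit i xs))))
        + scale ((-1) ^ Suc n) (r (f (take n xs)) (xs ! n))
        + (\<Sum>j\<le>n. \<Sum>i<j. scale ((-1) ^ Suc i) (f (omit i (xs[j := br (xs ! i) (xs ! j)]))))
      else 0)"

definition delta ::
  "('k::field \<Rightarrow> 'g::ab_group_add \<Rightarrow> 'g) \<Rightarrow> ('g \<Rightarrow> 'g \<Rightarrow> 'g) \<Rightarrow> nat \<Rightarrow> ('g list \<Rightarrow> 'g) \<Rightarrow> 'g list \<Rightarrow> 'g"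
  where
  "delta scale \<mu> = loday_coboundary scale (\<lambda>x u. \<mu> x u) (\<lambda>u x. \<mu> u x) \<mu>"

definition partial ::
  "('k::field \<Rightarrow> 'g::ab_group_add \<Rightarrow> 'g) \<Rightarrow> ('g \<Rightarrow> 'g \<Rightarrow> 'g) \<Rightarrow> ('g \<Rightarrow> 'g)
    \<Rightarrow> nat \<Rightarrow> ('g list \<Rightarrow> 'g) \<Rightarrow> 'g list \<Rightarrow> 'g" where
  "partial scale \<mu> T = loday_coboundary scale
     (\<lambda>x u. \<mu> (T x) u - T (\<mu> x u))
     (\<lambda>u x. \<mu> u (T x) - T (\<mu> u x))
     (\<lambda>x y. \<mu> x (T y) + \<mu> (T x) y)"

definition phi :: "('g::ab_group_add \<Rightarrow> 'g) \<Rightarrow> nat \<Rightarrow> ('g list \<Rightarrow> 'g) \<Rightarrow> 'g list \<Rightarrow> 'g" where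
  "phi T n f xs =
     (if length xs = n then f (map T xs) - (\<Sum>i<n. T (f ((map T xs)[i := xs ! i]))) else 0)"

text \<open>The complex starts in degree \<open>1\<close>; the following two definitions are meant for \<open>n \<ge> 1\<close>.\<close>

definition rbla_cochains ::
  "('k::field \<Rightarrow> 'g::ab_group_add \<Rightarrow> 'g) \<Rightarrow> nat \<Rightarrow> (('g list \<Rightarrow> 'g) \<times> ('g list \<Rightarrow> 'g)) set" where
  "rbla_cochains scale n = cochains scale n \<times> cochains scale (n - 1)"

definition rbla_d ::
  "('k::field \<Rightarrow> 'g::ab_group_add \<Rightarrow> 'g) \<Rightarrow> ('g \<Rightarrow> 'g \<Rightarrow> 'g) \<Rightarrow> ('g \<Rightarrow> 'g) \<Rightarrow> nat
    \<Rightarrow> ('g list \<Rightarrow> 'g) \<times> ('g list \<Rightarrow> 'g) \<Rightarrow> ('g list \<Rightarrow> 'g) \<times> ('g list \<Rightarrow> 'g)" where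
  "rbla_d scale \<mu> T n = (\<lambda>(\<alpha>, \<beta>). (delta scale \<mu> n \<alpha>, - partial scale \<mu> T (n - 1) \<beta> - phi T n \<alpha>))"

definition rbla_cocycles ::
  "('k::field \<Rightarrow> 'g::ab_group_add \<Rightarrow> 'g) \<Rightarrow> ('g \<Rightarrow> 'g \<Rightarrow> 'g) \<Rightarrow> ('g \<Rightarrow> 'g) \<Rightarrow> nat
    \<Rightarrow> (('g list \<Rightarrow> 'g) \<times> ('g list \<Rightarrow> 'g)) set" where
  "rbla_cocycles scale \<mu> T n = {c \<in> rbla_cochains scale n. rbla_d scale \<mu> T n c = 0}"

text \<open>The coboundaries and the cohomology of degree \<open>n\<close> are meant for \<open>n \<ge> 2\<close>.\<close>

definition rbla_coboundaries ::
  "('k::field \<Rightarrow> 'g::ab_group_add \<Rightarrow> 'g) \<Rightarrow> ('g \<Rightarrow> 'g \<Rightarrow> 'g) \<Rightarrow> ('g \<Rightarrow> 'g) \<Rightarrow> nat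
    \<Rightarrow> (('g list \<Rightarrow> 'g) \<times> ('g list \<Rightarrow> 'g)) set" where
  "rbla_coboundaries scale \<mu> T n = rbla_d scale \<mu> T (n - 1) ` rbla_cochains scale (n - 1)"

text \<open>The quotient is the set of cosets, whose zero element is the coset of \<open>0\<close>.\<close>

definition rbla_cohomology ::
  "('k::field \<Rightarrow> 'g::ab_group_add \<Rightarrow> 'g) \<Rightarrow> ('g \<Rightarrow> 'g \<Rightarrow> 'g) \<Rightarrow> ('g \<Rightarrow> 'g) \<Rightarrow> nat
    \<Rightarrow> (('g list \<Rightarrow> 'g) \<times> ('g list \<Rightarrow> 'g)) set set" where
  "rbla_cohomology scale \<mu> T n =
     (\<lambda>z. z +o rbla_coboundaries scale \<mu> T n) ` rbla_cocycles scale \<mu> T n"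

definition rbla_cohomology_vanishes ::
  "('k::field \<Rightarrow> 'g::ab_group_add \<Rightarrow> 'g) \<Rightarrow> ('g \<Rightarrow> 'g \<Rightarrow> 'g) \<Rightarrow> ('g \<Rightarrow> 'g) \<Rightarrow> nat \<Rightarrow> bool" where
  "rbla_cohomology_vanishes scale \<mu> T n \<longleftrightarrow>
     rbla_cohomology scale \<mu> T n = {0 +o rbla_coboundaries scale \<mu> T n}"


section \<open>Formal deformations\<close>

text \<open>\<open>\<gg>[[t]]\<close> is the type \<open>'g fps\<close>, on which \<open>\<bbbK>[[t]]\<close> acts by the Cauchy product.
  A power series of (bi)linear maps is the sequence of its coefficients, and \<open>extend1\<close>,
  \<open>extend2\<close> are the resulting \<open>\<bbbK>[[t]]\<close>-(bi)linear maps on \<open>\<gg>[[t]]\<close>.\<close>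

definition fps_scale ::
  "('k::comm_ring_1 \<Rightarrow> 'g::ab_group_add \<Rightarrow> 'g) \<Rightarrow> 'k fps \<Rightarrow> 'g fps \<Rightarrow> 'g fps" where
  "fps_scale scale a v = Abs_fps (\<lambda>n. \<Sum>i\<le>n. scale (fps_nth a i) (fps_nth v (n - i)))"

definition extend1 :: "(nat \<Rightarrow> 'g::ab_group_add \<Rightarrow> 'g) \<Rightarrow> 'g fps \<Rightarrow> 'g fps" where
  "extend1 F v = Abs_fps (\<lambda>n. \<Sum>i\<le>n. F i (fps_nth v (n - i)))"

definition extend2 :: "(nat \<Rightarrow> 'g::ab_group_add \<Rightarrow> 'g \<Rightarrow> 'g) \<Rightarrow> 'g fps \<Rightarrow> 'g fps \<Rightarrow> 'g fps" where
  "extend2 M v w =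
     Abs_fps (\<lambda>n. \<Sum>i\<le>n. \<Sum>j\<le>n - i. M i (fps_nth v j) (fps_nth w (n - i - j)))"

definition is_deformation ::
  "('k::field \<Rightarrow> 'g::ab_group_add \<Rightarrow> 'g) \<Rightarrow> ('g \<Rightarrow> 'g \<Rightarrow> 'g) \<Rightarrow> ('g \<Rightarrow> 'g)
    \<Rightarrow> (nat \<Rightarrow> 'g \<Rightarrow> 'g \<Rightarrow> 'g) \<Rightarrow> (nat \<Rightarrow> 'g \<Rightarrow> 'g) \<Rightarrow> bool" where
  "is_deformation scale \<mu> T \<mu>\<^sub>t T\<^sub>t \<longleftrightarrow>
     (\<forall>i x. module_hom scale scale (\<lambda>y. \<mu>\<^sub>t i x y)) \<and>
     (\<forall>i y. module_hom scale scale (\<lambda>x. \<mu>\<^sub>t i x y)) \<and>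
     (\<forall>i. module_hom scale scale (T\<^sub>t i)) \<and>
     \<mu>\<^sub>t 0 = \<mu> \<and> T\<^sub>t 0 = T \<and>
     rota_baxter_leibniz_algebra (fps_scale scale) (extend2 \<mu>\<^sub>t) (extend1 T\<^sub>t)"

definition equivalent_deformations ::
  "('k::field \<Rightarrow> 'g::ab_group_add \<Rightarrow> 'g)
    \<Rightarrow> (nat \<Rightarrow> 'g \<Rightarrow> 'g \<Rightarrow> 'g) \<times> (nat \<Rightarrow> 'g \<Rightarrow> 'g)
    \<Rightarrow> (nat \<Rightarrow> 'g \<Rightarrow> 'g \<Rightarrow> 'g) \<times> (nat \<Rightarrow> 'g \<Rightarrow> 'g) \<Rightarrow> bool" where
  "equivalent_deformations scale = (\<lambda>(\<mu>\<^sub>t, T\<^sub>t) (\<mu>\<^sub>t', T\<^sub>t').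
     \<exists>\<psi> :: nat \<Rightarrow> 'g \<Rightarrow> 'g.
       (\<forall>i. module_hom scale scale (\<psi> i)) \<and> \<psi> 0 = id \<and> bij (extend1 \<psi>) \<and>
       (\<forall>v w. extend1 \<psi> (extend2 \<mu>\<^sub>t' v w) = extend2 \<mu>\<^sub>t (extend1 \<psi> v) (extend1 \<psi> w)) \<and>
       (\<forall>v. extend1 \<psi> (extend1 T\<^sub>t' v) = extend1 T\<^sub>t (extend1 \<psi> v)))"

definition constant_series :: "'a \<Rightarrow> nat \<Rightarrow> 'a::zero" where
  "constant_series a = (\<lambda>i. if i = 0 then a else 0)"

definition trivial_deformation ::
  "('k::field \<Rightarrow> 'g::ab_group_add \<Rightarrow> 'g) \<Rightarrow> ('g \<Rightarrow> 'g \<Rightarrow> 'g) \<Rightarrow> ('g \<Rightarrow> 'g)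
    \<Rightarrow> (nat \<Rightarrow> 'g \<Rightarrow> 'g \<Rightarrow> 'g) \<Rightarrow> (nat \<Rightarrow> 'g \<Rightarrow> 'g) \<Rightarrow> bool" where
  "trivial_deformation scale \<mu> T \<mu>\<^sub>t T\<^sub>t \<longleftrightarrow>
     equivalent_deformations scale (\<mu>\<^sub>t, T\<^sub>t) (constant_series \<mu>, constant_series T)"

definition rigid ::
  "('k::field \<Rightarrow> 'g::ab_group_add \<Rightarrow> 'g) \<Rightarrow> ('g \<Rightarrow> 'g \<Rightarrow> 'g) \<Rightarrow> ('g \<Rightarrow> 'g) \<Rightarrow> bool" where
  "rigid scale \<mu> T \<longleftrightarrow>
     (\<forall>\<mu>\<^sub>t T\<^sub>t. is_deformation scale \<mu> T \<mu>\<^sub>t T\<^sub>t \<longrightarrow> trivial_deformation scale \<mu> T \<mu>\<^sub>t T\<^sub>t)"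

end

theory Submission
  imports Defs
begin

text \<open>The equivalence \<open>\<psi>\<^sub>t\<close> is built one coefficient at a time. If \<open>\<psi>\<^sub>t\<close> intertwines \<open>(\<mu>, T)\<close> with
  \<open>(\<mu>\<^sub>t, T\<^sub>t)\<close> below order \<open>n\<close>, then the two defects at order \<open>n\<close> form a 2-cocycle: expand the image
  under \<open>\<psi>\<^sub>t\<close> of the identities of \<open>(\<mu>, T)\<close> and compare with the same identities of \<open>(\<mu>\<^sub>t, T\<^sub>t)\<close>.
  Since \<open>(\<alpha>, \<beta>)\<close> and \<open>(\<alpha> + \<delta>\<^sup>0 \<beta>, 0)\<close> have the same coboundary, the defects are
  \<open>d\<^sup>1(a, 0)\<close> for a linear \<open>a\<close>, and adding \<open>a\<close> to \<open>\<psi>\<^sub>n\<close> removes them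
  without changing the lower orders.\<close>

section \<open>Coefficientwise extension of maps to power series\<close>

definition fps_shift_up :: "'g::ab_group_add fps \<Rightarrow> 'g fps" where
  "fps_shift_up v = Abs_fps (\<lambda>n. case n of 0 \<Rightarrow> 0 | Suc m \<Rightarrow> fps_nth v m)"

lemma fps_shift_up_nth [simp]:
  "fps_nth (fps_shift_up v) 0 = 0" "fps_nth (fps_shift_up v) (Suc n) = fps_nth v n"
  by (simp_all add: fps_shift_up_def)

section \<open>Coefficients, additivity and compatibility with multiplication by t
  (\<open>fps_shift_up\<close>)\<close>

lemma extend1_nth: "fps_nth (extend1 F v) n = (\<Sum>i\<le>n. F i (fps_nth v (n - i)))"
  by (simp add: extend1_def)

lemma extend2_nth:
  "fps_nth (extend2 M v w) n = (\<Sum>i\<le>n. \<Sum>j\<le>n - i. M i (fps_nth v j) (fps_nth w (n - i - j)))"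
  by (simp add: extend2_def)

lemma extend1_add:
  assumes "\<And>i x y. F i (x + y) = F i x + F i y"
  shows "extend1 F (v + w) = extend1 F v + extend1 F w"
  by (rule fps_ext) (simp add: extend1_nth assms sum.distrib)

lemma extend2_add_left:
  assumes "\<And>i x y z. M i (x + y) z = M i x z + M i y z"
  shows "extend2 M (v + v') w = extend2 M v w + extend2 M v' w"
  by (rule fps_ext) (simp add: extend2_nth assms sum.distrib)

lemma extend2_add_right:
  assumes "\<And>i x y z. M i x (y + z) = M i x y + M i x z"
  shows "extend2 M v (w + w') = extend2 M v w + extend2 M v w'"
  by (rule fps_ext) (simp add: extend2_nth assms sum.distrib)

lemma extend1_shift_up:
  assumes "\<And>i. F i 0 = 0"
  shows "extend1 F (fps_shift_up v) = fps_shift_up (extend1 F v)"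
proof (rule fps_ext)
  fix n show "fps_nth (extend1 F (fps_shift_up v)) n = fps_nth (fps_shift_up (extend1 F v)) n"
    by (cases n) (simp_all add: extend1_nth assms Suc_diff_le)
qed

lemma extend2_shift_up_left:
  assumes "\<And>i y. M i 0 y = 0"
  shows "extend2 M (fps_shift_up v) w = fps_shift_up (extend2 M v w)"
proof (rule fps_ext)
  fix n show "fps_nth (extend2 M (fps_shift_up v) w) n = fps_nth (fps_shift_up (extend2 M v w)) n"
  proof (cases n)
    case (Suc m)
    \<comment> \<open>The \<open>j = 0\<close> term vanishes since the shifted series has constant
      term 0, and the others are reindexed. The remaining index \<open>i = Suc m\<close> only has
      \<open>j = 0\<close>, so it contributes nothing.\<close>
    have "(\<Sum>j\<le>Suc m - i. M i (fps_nth (fps_shift_up v) j) (fps_nth w (Suc m - i - j)))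
        = (\<Sum>j\<le>m - i. M i (fps_nth v j) (fps_nth w (m - i - j)))" if "i \<le> m" for i
      using that by (simp add: Suc_diff_le sum.atMost_Suc_shift assms del: sum.atMost_Suc)
    then show ?thesis by (simp add: extend2_nth Suc assms)
  qed (simp add: extend2_nth assms)
qed

lemma extend2_shift_up_right:
  assumes "\<And>i x. M i x 0 = 0"
  shows "extend2 M v (fps_shift_up w) = fps_shift_up (extend2 M v w)"
proof (rule fps_ext)
  fix n show "fps_nth (extend2 M v (fps_shift_up w)) n = fps_nth (fps_shift_up (extend2 M v w)) n"
    by (cases n) (simp_all add: extend2_nth assms Suc_diff_le)
qed

section \<open>Lowest-order coefficients\<close>

lemma extend1_nth_leading:
  assumes "\<And>i. F i 0 = 0" "\<And>k. k < n \<Longrightarrow> fps_nth d k = 0"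
  shows "fps_nth (extend1 F d) n = F 0 (fps_nth d n)"
proof -
  \<comment> \<open>For \<open>i > 0\<close> the map \<open>F i\<close> is applied to a coefficient
    of \<open>d\<close> below order \<open>n\<close>, which is 0.\<close>
  have "fps_nth (extend1 F d) n = (\<Sum>i\<in>{0}. F i (fps_nth d (n - i)))"
    unfolding extend1_nth by (rule sum.mono_neutral_right) (auto simp: assms)
  then show ?thesis by simp
qed

lemma extend2_nth_leading_left:
  assumes "\<And>i y. M i 0 y = 0" "\<And>k. k < n \<Longrightarrow> fps_nth d k = 0"
  shows "fps_nth (extend2 M d w) n = M 0 (fps_nth d n) (fps_nth w 0)"
proof -
  have "fps_nth (extend2 M d w) n = (\<Sum>i\<in>{0}. \<Sum>j\<le>n - i. M i (fps_nth d j) (fps_nth w (n - i - j)))"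
    unfolding extend2_nth by (rule sum.mono_neutral_right) (auto simp: assms intro!: sum.neutral)
  moreover have "(\<Sum>j\<le>n. M 0 (fps_nth d j) (fps_nth w (n - j)))
      = (\<Sum>j\<in>{n}. M 0 (fps_nth d j) (fps_nth w (n - j)))"
    by (rule sum.mono_neutral_right) (auto simp: assms)
  ultimately show ?thesis by simp
qed

lemma extend2_nth_leading_right:
  assumes "\<And>i x. M i x 0 = 0" "\<And>k. k < n \<Longrightarrow> fps_nth d k = 0"
  shows "fps_nth (extend2 M v d) n = M 0 (fps_nth v 0) (fps_nth d n)"
proof -
  have "fps_nth (extend2 M v d) n = (\<Sum>i\<in>{0}. \<Sum>j\<le>n - i. M i (fps_nth v j) (fps_nth d (n - i - j)))"
    unfolding extend2_nth by (rule sum.mono_neutral_right) (auto simp: assms intro!: sum.neutral)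
  moreover have "(\<Sum>j\<le>n. M 0 (fps_nth v j) (fps_nth d (n - j)))
      = (\<Sum>j\<in>{0}. M 0 (fps_nth v j) (fps_nth d (n - j)))"
    by (rule sum.mono_neutral_right) (auto simp: assms)
  ultimately show ?thesis by simp
qed

section \<open>Values on constant series\<close>

lemma extend1_const:
  assumes "\<And>i. F i 0 = 0"
  shows "extend1 F (fps_const x) = Abs_fps (\<lambda>n. F n x)"
proof (rule fps_ext)
  fix n
  have "fps_nth (extend1 F (fps_const x)) n = (\<Sum>i\<in>{n}. F i (fps_nth (fps_const x) (n - i)))"
    unfolding extend1_nth by (rule sum.mono_neutral_right) (auto simp: assms)
  then show "fps_nth (extend1 F (fps_const x)) n = fps_nth (Abs_fps (\<lambda>n. F n x)) n" by simp
qed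

lemma extend2_const:
  assumes "\<And>i x. M i x 0 = 0" "\<And>i x. M i 0 x = 0"
  shows "extend2 M (fps_const x) (fps_const y) = Abs_fps (\<lambda>n. M n x y)"
proof (rule fps_ext)
  fix n
  have "fps_nth (extend2 M (fps_const x) (fps_const y)) n
      = (\<Sum>i\<in>{n}. \<Sum>j\<le>n - i. M i (fps_nth (fps_const x) j) (fps_nth (fps_const y) (n - i - j)))"
    unfolding extend2_nth by (rule sum.mono_neutral_right) (auto simp: assms intro!: sum.neutral)
  then show "fps_nth (extend2 M (fps_const x) (fps_const y)) n = fps_nth (Abs_fps (\<lambda>n. M n x y)) n"
    by simp
qed

lemma fps_shift_up_decomp: "v = fps_const (fps_nth v 0) + fps_shift_up (Abs_fps (\<lambda>n. fps_nth v (Suc n)))"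
proof (rule fps_ext)
  fix n show "fps_nth v n
    = fps_nth (fps_const (fps_nth v 0) + fps_shift_up (Abs_fps (\<lambda>n. fps_nth v (Suc n)))) n"
    by (cases n) simp_all
qed

text \<open>Write v = c + t v' with c constant. Coefficient 0 of both sides is then fixed by c, and
  coefficient n + 1 reduces to the value at c and coefficient n at v'. Induction on the order
  therefore extends agreement from constants to all series.\<close>

lemma shift_linear_eqI:
  fixes P Q :: "'g::ab_group_add fps \<Rightarrow> 'g fps"
  assumes "\<And>v w. P (v + w) = P v + P w" "\<And>v w. Q (v + w) = Q v + Q w"
    and "\<And>v. P (fps_shift_up v) = fps_shift_up (P v)"
    and "\<And>v. Q (fps_shift_up v) = fps_shift_up (Q v)"
    and "\<And>x. P (fps_const x) = Q (fps_const x)"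
  shows "P v = Q v"
proof (rule fps_ext)
  fix n show "fps_nth (P v) n = fps_nth (Q v) n"
  proof (induction n arbitrary: v)
    case 0
    show ?case
      by (subst (1 2) fps_shift_up_decomp[of v]) (simp add: assms)
  next
    case (Suc n)
    show ?case
      by (subst (1 2) fps_shift_up_decomp[of v]) (simp add: assms Suc.IH)
  qed
qed

section \<open>Inverting a series of maps that starts with the identity\<close>

function fps_solve :: "(nat \<Rightarrow> 'g::ab_group_add \<Rightarrow> 'g) \<Rightarrow> 'g fps \<Rightarrow> nat \<Rightarrow> 'g" where
  "fps_solve \<psi> w n = fps_nth w n - (\<Sum>i<n. \<psi> (n - i) (fps_solve \<psi> w i))"
  by auto
termination by (relation "measure (\<lambda>(_, _, n). n)") auto

declare fps_solve.simps [simp del]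

text \<open>Reversing the summation isolates the diagonal term: the equations for a preimage form a
  triangular system with identity diagonal.\<close>

lemma extend1_nth_unit:
  assumes "\<psi> 0 = id"
  shows "fps_nth (extend1 \<psi> v) n = fps_nth v n + (\<Sum>i<n. \<psi> (n - i) (fps_nth v i))"
proof -
  have "fps_nth (extend1 \<psi> v) n = (\<Sum>i\<le>n. \<psi> (n - i) (fps_nth v i))"
    unfolding extend1_nth atMost_atLeast0
    by (subst sum.atLeastAtMost_rev) simp
  then show ?thesis
    by (simp add: assms flip: lessThan_Suc_atMost)
qed

lemma bij_extend1:
  assumes "\<psi> 0 = id"
  shows "bij (extend1 \<psi>)"
proof (rule bijI)
  show "inj (extend1 \<psi>)"
  proof (rule injI, rule fps_ext)
    fix v w n assume eq: "extend1 \<psi> v = extend1 \<psi> w"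
    show "fps_nth v n = fps_nth w n"
    \<comment> \<open>Once the coefficients below \<open>n\<close> agree, the sums in
      \<open>extend1_nth_unit\<close> cancel and leave the coefficients at \<open>n\<close>.\<close>
    proof (induction n rule: less_induct)
      case (less n)
      then show ?case
        using arg_cong[OF eq, of "\<lambda>u. fps_nth u n"] by (simp add: extend1_nth_unit assms)
    qed
  qed
  \<comment> \<open>\<open>fps_solve\<close> is forward substitution in the triangular system: its
    recursion is the equation for coefficient \<open>n\<close>, solved for that coefficient.\<close>
  have "extend1 \<psi> (Abs_fps (fps_solve \<psi> w)) = w" for w
  proof (rule fps_ext)
    fix n show "fps_nth (extend1 \<psi> (Abs_fps (fps_solve \<psi> w))) n = fps_nth w n"
      using fps_solve.simps[of \<psi> w n] by (simp add: extend1_nth_unit assms)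
  qed
  then show "surj (extend1 \<psi>)" by (rule surjI)
qed

section \<open>Vanishing second cohomology\<close>

context
  fixes scale :: "'k::field \<Rightarrow> 'g::ab_group_add \<Rightarrow> 'g" and \<mu> T
  assumes rb: "rota_baxter_leibniz_algebra scale \<mu> T"
begin

interpretation rota_baxter_leibniz_algebra scale \<mu> T by (rule rb)

lemma zero_mem_rbla_coboundaries: "0 \<in> rbla_coboundaries scale \<mu> T 2"
proof -
  have z: "T 0 = 0" "\<And>x. \<mu> x 0 = 0" "\<And>x. \<mu> 0 x = 0"
    using module_hom.zero[OF linear_T] module_hom.zero[OF linear_left] module_hom.zero[OF linear_right]
    by auto
  have "module_hom scale scale (\<lambda>_. 0)"
    by unfold_locales auto
  then have "(0, 0) \<in> rbla_cochains scale 1"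
    by (simp add: rbla_cochains_def cochains_def)
  moreover have "rbla_d scale \<mu> T 1 (0, 0) = 0"
    by (auto simp: rbla_d_def delta_def partial_def phi_def loday_coboundary_def fun_eq_iff z zero_prod_def)
  ultimately show ?thesis
    unfolding rbla_coboundaries_def by (force simp: image_iff)
qed

text \<open>Since 0 is a coboundary, \<open>z\<close> lies in its own coset, and vanishing
  identifies that coset with the set of coboundaries.\<close>

lemma cocycle_is_coboundary:
  assumes van: "rbla_cohomology_vanishes scale \<mu> T 2" and z: "z \<in> rbla_cocycles scale \<mu> T 2"
  shows "z \<in> rbla_coboundaries scale \<mu> T 2"
proof -
  have "z +o rbla_coboundaries scale \<mu> T 2 = 0 +o rbla_coboundaries scale \<mu> T 2"
    using van z unfolding rbla_cohomology_vanishes_def rbla_cohomology_def by blast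
  moreover have "z \<in> z +o rbla_coboundaries scale \<mu> T 2"
    using zero_mem_rbla_coboundaries by (force simp: elt_set_plus_def)
  ultimately show ?thesis by simp
qed

text \<open>Translates vanishing cohomology from cochains on lists to ordinary maps. The two cocycle
  hypotheses are the linearised Leibniz and Rota-Baxter identities, that is, the two components of
  \<open>d\<^sup>2 (e, f) = 0\<close>. The cobounding pair is normalised so that only a linear map
  \<open>a\<close> remains.\<close>

lemma two_cocycle_trivial:
  assumes van: "rbla_cohomology_vanishes scale \<mu> T 2"
    and er: "\<And>x. module_hom scale scale (e x)"
    and el: "\<And>y. module_hom scale scale (\<lambda>x. e x y)"
    and f: "module_hom scale scale f"
    and e_cocycle: "\<And>x y z. \<mu> x (e y z) + e x (\<mu> y z)
          = \<mu> (e x y) z + e (\<mu> x y) z + (\<mu> y (e x z) + e y (\<mu> x z))"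
    and f_cocycle: "\<And>x y. e (T x) (T y) + \<mu> (f x) (T y) + \<mu> (T x) (f y)
          = f (\<mu> (T x) y + \<mu> x (T y)) + T (e (T x) y + e x (T y) + \<mu> (f x) y + \<mu> x (f y))"
  obtains a where "module_hom scale scale a"
    and "\<And>x y. e x y = \<mu> x (a y) + \<mu> (a x) y - a (\<mu> x y)"
    and "\<And>x. f x = T (a x) - a (T x)"
proof -
  have Tadd: "T (x + y) = T x + T y" for x y using module_hom.add[OF linear_T] .
  have fadd: "f (x + y) = f x + f y" for x y using module_hom.add[OF f] .
  define E where "E xs = (if length xs = 2 then e (xs ! 0) (xs ! 1) else 0)" for xs
  define F where "F xs = (if length xs = 1 then f (xs ! 0) else 0)" for xs
  have "E \<in> cochains scale 2"
    using er el by (auto simp: cochains_def E_def nth_list_update less_Suc_eq numeral_2_eq_2)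
  moreover have "F \<in> cochains scale 1"
    using f by (auto simp: cochains_def F_def)
  moreover have "delta scale \<mu> 2 E = 0"
  proof
    fix xs
    show "delta scale \<mu> 2 E xs = 0 xs"
    proof (cases "length xs = 3")
      case True
      then obtain x y z where "xs = [x, y, z]"
        by (auto simp: numeral_3_eq_3 length_Suc_conv)
      then show ?thesis
        using e_cocycle[of x y z]
        by (simp add: delta_def loday_coboundary_def omit_def E_def numeral_2_eq_2 algebra_simps)
    qed (simp add: delta_def loday_coboundary_def)
  qed
  moreover have "- partial scale \<mu> T 1 F - phi T 2 E = 0"
  proof
    fix xs
    show "(- partial scale \<mu> T 1 F - phi T 2 E) xs = 0 xs"
    proof (cases "length xs = 2")
      case True
      then obtain x y where "xs = [x, y]"
        by (auto simp: numeral_2_eq_2 length_Suc_conv)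
      then show ?thesis
        using f_cocycle[of x y]
        by (simp add: partial_def phi_def loday_coboundary_def omit_def E_def F_def numeral_2_eq_2
            Tadd fadd algebra_simps)
    qed (simp add: partial_def loday_coboundary_def phi_def)
  qed
  ultimately have "(E, F) \<in> rbla_cocycles scale \<mu> T 2"
    by (simp add: rbla_cocycles_def rbla_cochains_def rbla_d_def zero_prod_def)
  then have "(E, F) \<in> rbla_coboundaries scale \<mu> T 2"
    by (rule cocycle_is_coboundary[OF van])
  then obtain \<alpha> \<beta> where \<alpha>: "\<alpha> \<in> cochains scale 1"
    and E: "E = delta scale \<mu> 1 \<alpha>" and F: "F = - partial scale \<mu> T 0 \<beta> - phi T 1 \<alpha>"
    by (auto simp: rbla_coboundaries_def rbla_cochains_def rbla_d_def)
  \<comment> \<open>the linear map \<open>\<alpha> + \<delta>\<^sup>0 \<beta>\<close>\<close>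
  define a where "a x = \<alpha> [x] - \<mu> (\<beta> []) x" for x
  have \<alpha>_hom: "module_hom scale scale (\<lambda>x. \<alpha> [x])"
  proof -
    \<comment> \<open>The list \<open>[0]\<close> is a dummy: updating its only entry gives
      \<open>[u]\<close>, so linearity in slot 0 is linearity of \<open>\<alpha>\<close> on
      singletons.\<close>
    have "length [0::'g] = 1 \<longrightarrow> 0 < (1::nat) \<longrightarrow> module_hom scale scale (\<lambda>u. \<alpha> ([0][0 := u]))"
      using \<alpha> unfolding cochains_def mem_Collect_eq by blast
    then show ?thesis by simp
  qed
  have a: "module_hom scale scale a"
    unfolding a_def
    by unfold_locales
       (simp_all add: module_hom.add[OF \<alpha>_hom] module_hom.scale[OF \<alpha>_hom] module_hom.add[OF linear_right]
        module_hom.scale[OF linear_right] scale_right_diff_distrib)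
  \<comment> \<open>Left multiplication by \<open>\<beta> []\<close> is a derivation by the Leibniz
    identity, so the term added to \<open>\<alpha>\<close> has zero coboundary under
    \<open>delta\<close>.\<close>
  have "e x y = \<mu> x (a y) + \<mu> (a x) y - a (\<mu> x y)" for x y
    using fun_cong[OF E, of "[x, y]"] leibniz[of "\<beta> []" x y]
    by (simp add: delta_def loday_coboundary_def omit_def E_def a_def
        module_hom.diff[OF linear_right] module_hom.diff[OF linear_left])
  \<comment> \<open>The part of \<open>f\<close> coming from \<open>\<beta>\<close> is
    \<open>\<mu> (\<beta> []) (T x) - T (\<mu> (\<beta> []) x)\<close>, which is just what the
    correction term of \<open>a\<close> produces.\<close>
  moreover have "f x = T (a x) - a (T x)" for x
    using fun_cong[OF F, of "[x]"]
    by (simp add: partial_def phi_def loday_coboundary_def omit_def F_def a_def module_hom.diff[OF linear_T])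
  ultimately show thesis using that a by blast
qed

end

section \<open>Deformations\<close>

context
  fixes scale :: "'k::field \<Rightarrow> 'g::ab_group_add \<Rightarrow> 'g" and \<mu> T \<mu>t Tt
  assumes rb: "rota_baxter_leibniz_algebra scale \<mu> T"
    and deformation: "is_deformation scale \<mu> T \<mu>t Tt"
begin

interpretation rota_baxter_leibniz_algebra scale \<mu> T by (rule rb)

interpretation ext: rota_baxter_leibniz_algebra "fps_scale scale" "extend2 \<mu>t" "extend1 Tt"
  using deformation by (simp add: is_deformation_def)

section \<open>Coefficients of the deformed structure\<close>

lemma coeff_hom:
  "module_hom scale scale (\<lambda>y. \<mu>t i x y)" "module_hom scale scale (\<lambda>x. \<mu>t i x y)"
  "module_hom scale scale (Tt i)" "\<mu>t 0 = \<mu>" "Tt 0 = T"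
  using deformation by (auto simp: is_deformation_def)

lemmas coeff_simps = coeff_hom(4,5)
  module_hom.add[OF coeff_hom(1)] module_hom.add[OF coeff_hom(2)] module_hom.add[OF coeff_hom(3)]
  module_hom.zero[OF coeff_hom(1)] module_hom.zero[OF coeff_hom(2)] module_hom.zero[OF coeff_hom(3)]
  module_hom.scale[OF coeff_hom(1)] module_hom.scale[OF coeff_hom(2)] module_hom.scale[OF coeff_hom(3)]

lemmas ext_add = module_hom.add[OF ext.linear_right] module_hom.add[OF ext.linear_left]
  module_hom.add[OF ext.linear_T]

section \<open>Defects of a candidate equivalence\<close>

definition bracket_defect :: "(nat \<Rightarrow> 'g \<Rightarrow> 'g) \<Rightarrow> 'g \<Rightarrow> 'g \<Rightarrow> 'g fps" where
  "bracket_defect \<psi> x y = Abs_fps (\<lambda>n. \<psi> n (\<mu> x y))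
     - extend2 \<mu>t (Abs_fps (\<lambda>n. \<psi> n x)) (Abs_fps (\<lambda>n. \<psi> n y))"

definition operator_defect :: "(nat \<Rightarrow> 'g \<Rightarrow> 'g) \<Rightarrow> 'g \<Rightarrow> 'g fps" where
  "operator_defect \<psi> x = Abs_fps (\<lambda>n. \<psi> n (T x)) - extend1 Tt (Abs_fps (\<lambda>n. \<psi> n x))"

text \<open>The defects are tested on constants only; \<open>trivial_if_intertwines\<close> passes
  to all power series.\<close>

definition intertwines_at :: "(nat \<Rightarrow> 'g \<Rightarrow> 'g) \<Rightarrow> nat \<Rightarrow> bool" where
  "intertwines_at \<psi> n \<longleftrightarrow>
     (\<forall>x y. fps_nth (bracket_defect \<psi> x y) n = 0) \<and> (\<forall>x. fps_nth (operator_defect \<psi> x) n = 0)"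

text \<open>Coefficient \<open>n\<close> of the defects involves only the coefficients of \<psi> up
  to \<open>n\<close>, so later corrections cannot spoil an order already settled.\<close>

lemma intertwines_at_cong:
  assumes "\<And>k. k \<le> n \<Longrightarrow> \<psi> k = \<psi>' k"
  shows "intertwines_at \<psi> n \<longleftrightarrow> intertwines_at \<psi>' n"
  using assms
  by (simp add: intertwines_at_def bracket_defect_def operator_defect_def extend1_nth extend2_nth)

section \<open>The defects as cocycles and their successive removal\<close>

lemma defect_hom:
  assumes "\<And>i. module_hom scale scale (\<psi> i)"
  shows "module_hom scale scale (\<lambda>y. fps_nth (bracket_defect \<psi> x y) n)"
    and "module_hom scale scale (\<lambda>x. fps_nth (bracket_defect \<psi> x y) n)"
    and "module_hom scale scale (\<lambda>x. fps_nth (operator_defect \<psi> x) n)"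
  by (unfold_locales;
      simp add: bracket_defect_def operator_defect_def extend1_nth extend2_nth
      module_hom.add[OF assms] module_hom.scale[OF assms] coeff_simps
      module_hom.add[OF linear_right] module_hom.scale[OF linear_right]
      module_hom.add[OF linear_left] module_hom.scale[OF linear_left]
      module_hom.add[OF linear_T] module_hom.scale[OF linear_T]
      sum.distrib scale_sum_right scale_right_diff_distrib)+

text \<open>The full defects satisfy identities over the power series. As they start at order
  \<open>n\<close>, coefficient \<open>n\<close> of each identity sees only the leading terms
  \<open>\<mu>t 0 = \<mu>\<close>, \<open>Tt 0 = T\<close> and \<open>\<psi> 0 = id\<close>, which
  turns it into a cocycle equation.\<close>

lemma defect_cocycle:
  assumes hom: "\<And>i. module_hom scale scale (\<psi> i)" and \<psi>0: "\<psi> 0 = id"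
    and below: "\<And>k. k < n \<Longrightarrow> intertwines_at \<psi> k"
  defines "e \<equiv> \<lambda>x y. fps_nth (bracket_defect \<psi> x y) n"
    and "f \<equiv> \<lambda>x. fps_nth (operator_defect \<psi> x) n"
  shows "\<mu> x (e y z) + e x (\<mu> y z)
          = \<mu> (e x y) z + e (\<mu> x y) z + (\<mu> y (e x z) + e y (\<mu> x z))" (is ?leibniz)
    and "e (T x) (T y) + \<mu> (f x) (T y) + \<mu> (T x) (f y)
          = f (\<mu> (T x) y + \<mu> x (T y)) + T (e (T x) y + e x (T y) + \<mu> (f x) y + \<mu> x (f y))" (is ?rb)
proof -
  let ?B = "extend2 \<mu>t" and ?S = "extend1 Tt"
  define \<Psi> where "\<Psi> x = Abs_fps (\<lambda>n. \<psi> n x)" for x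
  define D where "D = bracket_defect \<psi>"
  define O' where "O' = operator_defect \<psi>"
  have \<Psi>_add: "\<Psi> (x + y) = \<Psi> x + \<Psi> y" for x y
    by (rule fps_ext) (simp add: \<Psi>_def module_hom.add[OF hom])
  have \<Psi>_0: "fps_nth (\<Psi> x) 0 = x" for x by (simp add: \<Psi>_def \<psi>0)
  have \<Psi>_\<mu>: "\<Psi> (\<mu> x y) = D x y + ?B (\<Psi> x) (\<Psi> y)" for x y
    by (simp add: D_def bracket_defect_def \<Psi>_def)
  have \<Psi>_T: "\<Psi> (T x) = O' x + ?S (\<Psi> x)" for x
    by (simp add: O'_def operator_defect_def \<Psi>_def)
  have low: "k < n \<Longrightarrow> fps_nth (D x y) k = 0" "k < n \<Longrightarrow> fps_nth (O' x) k = 0" for k x y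
    using below by (auto simp: intertwines_at_def D_def O'_def)
  have at: "fps_nth (D x y) n = e x y" "fps_nth (O' x) n = f x" for x y
    by (simp_all add: D_def O'_def e_def f_def)
  \<comment> \<open>Stated for every order \<open>k\<close>: orders below \<open>n\<close> are
    needed to see that the argument \<open>?d\<close> of \<open>?S\<close> below starts at order
    \<open>n\<close>.\<close>
  have B_left: "fps_nth (?B d w) k = \<mu> (fps_nth d k) (fps_nth w 0)"
    if "\<And>j. j < k \<Longrightarrow> fps_nth d j = 0" for d w k
    using extend2_nth_leading_left[of \<mu>t k d w] that by (simp add: coeff_simps)
  have B_right: "fps_nth (?B w d) k = \<mu> (fps_nth w 0) (fps_nth d k)"
    if "\<And>j. j < k \<Longrightarrow> fps_nth d j = 0" for d w k
    using extend2_nth_leading_right[of \<mu>t k d w] that by (simp add: coeff_simps)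
  have S_lead: "fps_nth (?S d) k = T (fps_nth d k)"
    if "\<And>j. j < k \<Longrightarrow> fps_nth d j = 0" for d k
    using extend1_nth_leading[of Tt k d] that by (simp add: coeff_simps)
  have S_0: "fps_nth (?S (\<Psi> x)) 0 = T x" for x
    using S_lead[of 0 "\<Psi> x"] by (simp add: \<Psi>_0)
  have z: "\<mu> x 0 = 0" "\<mu> 0 x = 0" for x
    using module_hom.zero[OF linear_right] module_hom.zero[OF linear_left] by auto

  have "\<Psi> (\<mu> x (\<mu> y z)) = \<Psi> (\<mu> (\<mu> x y) z) + \<Psi> (\<mu> y (\<mu> x z))"
    by (subst leibniz) (rule \<Psi>_add)
  moreover have "?B (\<Psi> x) (?B (\<Psi> y) (\<Psi> z))
      = ?B (?B (\<Psi> x) (\<Psi> y)) (\<Psi> z) + ?B (\<Psi> y) (?B (\<Psi> x) (\<Psi> z))"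
    by (rule ext.leibniz)
  \<comment> \<open>Replacing each \<open>\<Psi>\<close> of a bracket by defect plus deformed
    bracket, the triple deformed brackets cancel by the deformed Leibniz identity.\<close>
  ultimately have "D x (\<mu> y z) + ?B (\<Psi> x) (D y z)
      = D (\<mu> x y) z + ?B (D x y) (\<Psi> z) + (D y (\<mu> x z) + ?B (\<Psi> y) (D x z))"
    by (simp add: \<Psi>_\<mu> ext_add algebra_simps)
  from arg_cong[OF this, of "\<lambda>v. fps_nth v n"] show ?leibniz
    by (simp add: at low B_left B_right \<Psi>_0 algebra_simps)

  let ?u = "\<mu> (T x) y + \<mu> x (T y)"
  \<comment> \<open>The excess of \<open>\<Psi> ?u\<close> over the argument of \<open>?S\<close> in
    the deformed Rota-Baxter identity for \<open>\<Psi> x\<close> and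
    \<open>\<Psi> y\<close>.\<close>
  let ?d = "D (T x) y + D x (T y) + ?B (O' x) (\<Psi> y) + ?B (\<Psi> x) (O' y)"
  have "\<Psi> (\<mu> (T x) (T y)) = \<Psi> (T ?u)"
    by (simp add: rota_baxter)
  \<comment> \<open>Keeping \<open>\<Psi> (T y)\<close> whole in the second term avoids a term
    quadratic in \<open>O'\<close>.\<close>
  moreover have "\<Psi> (\<mu> (T x) (T y)) = D (T x) (T y) + ?B (O' x) (\<Psi> (T y)) + ?B (?S (\<Psi> x)) (O' y)
      + ?B (?S (\<Psi> x)) (?S (\<Psi> y))"
    by (simp add: \<Psi>_\<mu> \<Psi>_T ext_add algebra_simps)
  moreover have "\<Psi> (T ?u) = O' ?u + ?S ?d + ?S (?B (?S (\<Psi> x)) (\<Psi> y) + ?B (\<Psi> x) (?S (\<Psi> y)))"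
    by (simp only: \<Psi>_T[of ?u]) (simp add: \<Psi>_add \<Psi>_\<mu> \<Psi>_T ext_add algebra_simps)
  ultimately have "D (T x) (T y) + ?B (O' x) (\<Psi> (T y)) + ?B (?S (\<Psi> x)) (O' y) = O' ?u + ?S ?d"
    by (simp add: ext.rota_baxter)
  from arg_cong[OF this, of "\<lambda>v. fps_nth v n"] show ?rb
    by (simp add: at low B_left B_right S_lead S_0 \<Psi>_0 z algebra_simps)
qed

text \<open>Adding a linear map to \<open>\<psi> n\<close> changes the order-\<open>n\<close>
  defects by minus its coboundary, so a map cobounding the defects cancels them. Positivity of
  \<open>n\<close> preserves \<open>\<psi> 0 = id\<close> and keeps terms quadratic in the
  correction out of order \<open>n\<close>.\<close>

lemma correct_coefficient:
  assumes van: "rbla_cohomology_vanishes scale \<mu> T 2"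
    and hom: "\<And>i. module_hom scale scale (\<psi> i)" and \<psi>0: "\<psi> 0 = id"
    and below: "\<And>k. k < n \<Longrightarrow> intertwines_at \<psi> k" and n: "n > 0"
  obtains a where "module_hom scale scale a" "intertwines_at (\<psi>(n := a)) n"
proof -
  from two_cocycle_trivial[OF rb van defect_hom[OF hom] defect_cocycle[OF hom \<psi>0 below]]
  obtain a where a: "module_hom scale scale a"
    and e: "\<And>x y. fps_nth (bracket_defect \<psi> x y) n = \<mu> x (a y) + \<mu> (a x) y - a (\<mu> x y)"
    and f: "\<And>x. fps_nth (operator_defect \<psi> x) n = T (a x) - a (T x)"
    by blast
  \<comment> \<open>The \<open>a\<close> just obtained is only the correction; the witness for the
    conclusion is the sum with the old coefficient.\<close>
  let ?\<psi>' = "\<psi>(n := (\<lambda>x. \<psi> n x + a x))"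
  define \<Psi> where "\<Psi> x = Abs_fps (\<lambda>k. \<psi> k x)" for x
  define A where "A x = Abs_fps (\<lambda>k. if k = n then a x else 0)" for x
  have \<Psi>': "Abs_fps (\<lambda>k. ?\<psi>' k x) = \<Psi> x + A x" for x
    by (rule fps_ext) (simp add: \<Psi>_def A_def)
  have lead: "fps_nth (extend2 \<mu>t (A x) w) n = \<mu> (a x) (fps_nth w 0)"
    "fps_nth (extend2 \<mu>t w (A x)) n = \<mu> (fps_nth w 0) (a x)"
    "fps_nth (extend1 Tt (A x)) n = T (a x)" for x w
    using extend2_nth_leading_left[of \<mu>t n "A x" w] extend2_nth_leading_right[of \<mu>t n "A x" w]
      extend1_nth_leading[of Tt n "A x"] by (simp_all add: coeff_simps A_def)
  have 0: "fps_nth (\<Psi> x) 0 = x" "fps_nth (A x) 0 = 0" for x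
    using n by (simp_all add: \<Psi>_def A_def \<psi>0)
  have z: "\<mu> x 0 = 0" "\<mu> 0 x = 0" for x
    using module_hom.zero[OF linear_right] module_hom.zero[OF linear_left] by auto
  have "fps_nth (bracket_defect ?\<psi>' x y) n = 0" for x y
    using e[of x y] unfolding bracket_defect_def \<Psi>' \<Psi>_def[symmetric]
    by (simp add: ext_add lead 0 z) (simp add: A_def algebra_simps)
  moreover have "fps_nth (operator_defect ?\<psi>' x) n = 0" for x
    using f[of x] unfolding operator_defect_def \<Psi>' \<Psi>_def[symmetric]
    by (simp add: ext_add lead) (simp add: A_def algebra_simps)
  ultimately have "intertwines_at ?\<psi>' n" by (simp add: intertwines_at_def)
  moreover have "module_hom scale scale (\<lambda>x. \<psi> n x + a x)"
    by unfold_locales (simp_all add: module_hom.add[OF a] module_hom.scale[OF a]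
        module_hom.add[OF hom] module_hom.scale[OF hom] scale_right_distrib)
  ultimately show thesis using that by blast
qed

text \<open>Corrections at successive orders are chosen by dependent choice. Stage \<open>n\<close>
  is a whole sequence that is correct through order \<open>n\<close>, and the next stage preserves
  its entries up to \<open>n\<close>, so the diagonal is correct at every order.\<close>

lemma exists_intertwiner:
  assumes van: "rbla_cohomology_vanishes scale \<mu> T 2"
  obtains \<psi> where "\<And>i. module_hom scale scale (\<psi> i)" "\<psi> 0 = id" "\<And>n. intertwines_at \<psi> n"
proof -
  define P where "P n \<psi> \<longleftrightarrow> (\<forall>i. module_hom scale scale (\<psi> i)) \<and> \<psi> 0 = id \<and> (\<forall>k\<le>n. intertwines_at \<psi> k)"
    for n \<psi>
  have "\<exists>s. \<forall>n. P n (s n) \<and> (\<forall>k\<le>n. s (Suc n) k = s n k)"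
  proof (rule dependent_nat_choice)
    have "module_hom scale scale (constant_series id i)" for i
      by unfold_locales (auto simp: constant_series_def)
    \<comment> \<open>At order 0 the deformation is (\<mu>, T) itself, so the identity
      intertwines.\<close>
    moreover have "intertwines_at (constant_series id) 0"
      by (simp add: intertwines_at_def bracket_defect_def operator_defect_def extend1_nth extend2_nth
          constant_series_def coeff_simps)
    ultimately have "P 0 (constant_series id)"
      by (simp add: P_def) (simp add: constant_series_def)
    then show "\<exists>s. P 0 s" by blast
  next
    fix \<psi> n assume P: "P n \<psi>"
    then have hom: "\<And>i. module_hom scale scale (\<psi> i)" and \<psi>0: "\<psi> 0 = id"
      and below: "\<And>k. k < Suc n \<Longrightarrow> intertwines_at \<psi> k"
      by (auto simp: P_def)
    obtain a where a: "module_hom scale scale a" "intertwines_at (\<psi>(Suc n := a)) (Suc n)"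
      using correct_coefficient[OF van hom \<psi>0 below] by blast
    have "intertwines_at (\<psi>(Suc n := a)) k" if "k \<le> Suc n" for k
    proof (cases "k = Suc n")
      case False
      with that have "k < Suc n" by simp
      with below[OF this] show ?thesis
        using intertwines_at_cong[of k "\<psi>(Suc n := a)" \<psi>] by simp
    qed (use a in simp)
    then have "P (Suc n) (\<psi>(Suc n := a))"
      using hom \<psi>0 a by (simp add: P_def)
    then show "\<exists>s. P (Suc n) s \<and> (\<forall>k\<le>n. s k = \<psi> k)"
      by (intro exI[of _ "\<psi>(Suc n := a)"]) simp
  qed
  then obtain s where s: "\<And>n. P n (s n)" "\<And>n k. k \<le> n \<Longrightarrow> s (Suc n) k = s n k" by blast
  have stable: "s n k = s k k" if "k \<le> n" for k n
    using that by (induction n rule: dec_induct) (simp_all add: s(2))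
  define \<psi> where "\<psi> n = s n n" for n
  have "intertwines_at \<psi> n" for n
  proof -
    have "\<psi> k = s n k" if "k \<le> n" for k
      unfolding \<psi>_def by (rule stable[OF that, symmetric])
    then have "intertwines_at \<psi> n \<longleftrightarrow> intertwines_at (s n) n"
      by (rule intertwines_at_cong)
    then show ?thesis using s(1)[of n] by (simp add: P_def)
  qed
  moreover have "module_hom scale scale (\<psi> i)" for i
    using s(1)[of i] by (simp add: P_def \<psi>_def)
  moreover have "\<psi> 0 = id"
    using s(1)[of 0] by (simp add: P_def \<psi>_def)
  ultimately show thesis using that by blast
qed

section \<open>From constants to all power series\<close>

lemma trivial_if_intertwines:
  assumes hom: "\<And>i. module_hom scale scale (\<psi> i)" and \<psi>0: "\<psi> 0 = id"
    and intertwines: "\<And>n. intertwines_at \<psi> n"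
  shows "trivial_deformation scale \<mu> T \<mu>t Tt"
proof -
  let ?M = "extend2 (constant_series \<mu>)" and ?C = "extend1 (constant_series T)"
  have \<psi>_const: "extend1 \<psi> (fps_const x) = Abs_fps (\<lambda>n. \<psi> n x)" for x
    by (rule extend1_const) (rule module_hom.zero[OF hom])
  have const_add: "constant_series T i (x + y) = constant_series T i x + constant_series T i y"
    "constant_series \<mu> i (x + y) z = constant_series \<mu> i x z + constant_series \<mu> i y z"
    "constant_series \<mu> i z (x + y) = constant_series \<mu> i z x + constant_series \<mu> i z y"
    "constant_series T i 0 = 0" "constant_series \<mu> i x 0 = 0" "constant_series \<mu> i 0 x = 0" for i x y z
    using module_hom.add[OF linear_right] module_hom.add[OF linear_left] module_hom.add[OF linear_T]
      module_hom.zero[OF linear_right] module_hom.zero[OF linear_left] module_hom.zero[OF linear_T]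
    by (auto simp: constant_series_def)
  have "?C (fps_const x) = Abs_fps (\<lambda>n. constant_series T n x)"
    "?M (fps_const x) (fps_const y) = Abs_fps (\<lambda>n. constant_series \<mu> n x y)" for x y
    by (intro extend1_const extend2_const const_add)+
  then have extend_constant_series: "?C (fps_const x) = fps_const (T x)"
    "?M (fps_const x) (fps_const y) = fps_const (\<mu> x y)" for x y
    by (auto simp: fps_eq_iff constant_series_def)
  have add: "extend1 \<psi> (v + w) = extend1 \<psi> v + extend1 \<psi> w" "?C (v + w) = ?C v + ?C w"
    "?M (v + w) u = ?M v u + ?M w u" "?M u (v + w) = ?M u v + ?M u w" for u v w
    by (intro extend1_add extend2_add_left extend2_add_right const_add module_hom.add[OF hom])+
  \<comment> \<open>Together with additivity, commuting with t is what
    \<open>shift_linear_eqI\<close> asks of both sides of the intertwining equations.\<close>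
  have shift: "extend1 \<psi> (fps_shift_up v) = fps_shift_up (extend1 \<psi> v)"
    "?C (fps_shift_up v) = fps_shift_up (?C v)"
    "extend1 Tt (fps_shift_up v) = fps_shift_up (extend1 Tt v)"
    "?M (fps_shift_up v) u = fps_shift_up (?M v u)" "?M u (fps_shift_up v) = fps_shift_up (?M u v)"
    "extend2 \<mu>t (fps_shift_up v) u = fps_shift_up (extend2 \<mu>t v u)"
    "extend2 \<mu>t u (fps_shift_up v) = fps_shift_up (extend2 \<mu>t u v)" for u v
    by (intro extend1_shift_up extend2_shift_up_left extend2_shift_up_right const_add coeff_simps
        module_hom.zero[OF hom])+
  note linear_simps = add ext_add shift
  have base: "extend1 \<psi> (?M (fps_const x) (fps_const y))
      = extend2 \<mu>t (extend1 \<psi> (fps_const x)) (extend1 \<psi> (fps_const y))" for x y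
  proof -
    have "bracket_defect \<psi> x y = 0"
      by (rule fps_ext) (use intertwines in \<open>simp add: intertwines_at_def\<close>)
    then show ?thesis by (simp add: bracket_defect_def extend_constant_series \<psi>_const)
  qed
  \<comment> \<open>The bracket equation is extended one argument at a time: first the right one
    with a constant on the left, then the left one.\<close>
  have const_left: "extend1 \<psi> (?M (fps_const x) w) = extend2 \<mu>t (extend1 \<psi> (fps_const x)) (extend1 \<psi> w)" for x w
    by (rule shift_linear_eqI[where P = "\<lambda>w. extend1 \<psi> (?M (fps_const x) w)"
          and Q = "\<lambda>w. extend2 \<mu>t (extend1 \<psi> (fps_const x)) (extend1 \<psi> w)"])
       (simp_all only: linear_simps base)
  have "extend1 \<psi> (?M v w) = extend2 \<mu>t (extend1 \<psi> v) (extend1 \<psi> w)" for v w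
    by (rule shift_linear_eqI[where P = "\<lambda>v. extend1 \<psi> (?M v w)"
          and Q = "\<lambda>v. extend2 \<mu>t (extend1 \<psi> v) (extend1 \<psi> w)"])
       (simp_all only: linear_simps const_left)
  moreover have "extend1 \<psi> (?C v) = extend1 Tt (extend1 \<psi> v)" for v
  proof (rule shift_linear_eqI[where P = "\<lambda>v. extend1 \<psi> (?C v)"
        and Q = "\<lambda>v. extend1 Tt (extend1 \<psi> v)"])
    fix x
    have "operator_defect \<psi> x = 0"
      by (rule fps_ext) (use intertwines in \<open>simp add: intertwines_at_def\<close>)
    then show "extend1 \<psi> (?C (fps_const x)) = extend1 Tt (extend1 \<psi> (fps_const x))"
      by (simp add: operator_defect_def extend_constant_series \<psi>_const)
  qed (simp_all only: linear_simps)
  ultimately show ?thesis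
    unfolding trivial_deformation_def equivalent_deformations_def
    using hom \<psi>0 bij_extend1[of \<psi>, OF \<psi>0] by blast
qed

end

theorem theorem5p8:
  fixes scale :: "'k::field \<Rightarrow> 'g::ab_group_add \<Rightarrow> 'g"
    and \<mu> :: "'g \<Rightarrow> 'g \<Rightarrow> 'g"
    and T :: "'g \<Rightarrow> 'g"
  assumes "rota_baxter_leibniz_algebra scale \<mu> T"
    and "rbla_cohomology_vanishes scale \<mu> T 2"
  shows "rigid scale \<mu> T"
  unfolding rigid_def
proof (intro allI impI)
  fix \<mu>t Tt assume deformation: "is_deformation scale \<mu> T \<mu>t Tt"
  obtain \<psi> where "\<And>i. module_hom scale scale (\<psi> i)" "\<psi> 0 = id"
    "\<And>n. intertwines_at \<mu> T \<mu>t Tt \<psi> n"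
    using exists_intertwiner[OF assms(1) deformation assms(2)] by blast
  then show "trivial_deformation scale \<mu> T \<mu>t Tt"
    using trivial_if_intertwines[OF assms(1) deformation] by blast
qed

end
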